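(* For every integer $n \ge 0$, $$\det\left(H_{i+j}\right)_{i,j=0}^{n} = (-1)^n\, \frac{2 H_n}{\binom{2n}{n}\prod_{j=1}^{n-1}(2j+1)\binom{2j}{j}^2}.$$
   Context: $H_m = \sum_{k=1}^{m} \frac{1}{k}$ denotes the $m$-th harmonic number ($H_0 = 0$). The notation $(a_{i,j})_{i,j=0}^{n}$ denotes the $(n+1)\times(n+1)$ matrix with indices $0\le i,j\le n$. Empty products equal $1$. *)

theory Defs
  imports "HOL-Analysis.Harmonic_Numbers" "Jordan_Normal_Form.Determinant"
begin

end

theory Submission
  imports Defs
begin

text \<open>
  The matrix is the Gram matrix of the monomials for the symmetric form \<open>\<langle>p, q\<rangle> = L (p q)\<close>, where
  \<open>L p\<close> is the integral of \<open>(p(1) - p(x)) / (1 - x)\<close> over \<open>[0, 1]\<close>, so that \<open>L (x^m)\<close> is the \<open>m\<close>-th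
  harmonic number. In the basis of shifted Legendre polynomials \<open>P\<^sub>j\<close>, normalised by \<open>P\<^sub>j(1) = 1\<close>,
  orthogonality to lower degrees gives \<open>L (P\<^sub>i P\<^sub>j) = L P\<^sub>m = 2 H\<^sub>m\<close> with \<open>m = max i j\<close>. The determinant
  of \<open>2 H\<^sub>m\<close> is elementary, and the change of basis is triangular with the central binomial
  coefficients on the diagonal. Integrals against \<open>P\<^sub>j\<close> are replaced by \<open>j\<close>-th finite differences at
  \<open>0\<close>, since the coefficients of \<open>P\<^sub>j\<close> are alternating binomial weights times the polynomial
  \<open>(l + j) choose j\<close> in \<open>l\<close>.
\<close>

section \<open>Finite differences at 0\<close>

text \<open>The exponent \<open>j + l\<close> has the parity of \<open>j - l\<close> and avoids
  truncated subtraction.\<close>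

definition fdiff :: "nat \<Rightarrow> (nat \<Rightarrow> real) \<Rightarrow> real" where
  "fdiff j f = (\<Sum>l\<le>j. (- 1) ^ (j + l) * real (j choose l) * f l)"

lemma fdiff_0 [simp]: "fdiff 0 f = f 0"
  by (simp add: fdiff_def)

text \<open>Pascal's rule splits the weights. Peeling off a difference of \<open>f\<close> first
  drives the later inductions on the order.\<close>

lemma fdiff_Suc: "fdiff (Suc j) f = fdiff j (\<lambda>x. f (Suc x) - f x)"
proof -
  have "fdiff (Suc j) f = (- 1) ^ Suc j * f 0 +
      (\<Sum>l\<le>j. (- 1) ^ (j + l) * real (Suc j choose Suc l) * f (Suc l))"
    unfolding fdiff_def by (subst sum.atMost_Suc_shift) simp
  also have "(\<Sum>l\<le>j. (- 1) ^ (j + l) * real (Suc j choose Suc l) * f (Suc l)) =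
      fdiff j (\<lambda>x. f (Suc x)) +
      (\<Sum>l\<le>j. (- 1) ^ (j + l) * real (j choose Suc l) * f (Suc l))"
    by (simp add: fdiff_def sum.distrib algebra_simps)
  also have "(\<Sum>l\<le>j. (- 1) ^ (j + l) * real (j choose Suc l) * f (Suc l)) =
      (\<Sum>l<j. (- 1) ^ (j + l) * real (j choose Suc l) * f (Suc l))"
    by (rule sum.mono_neutral_right) (auto simp: binomial_eq_0)
  also have "(- 1) ^ Suc j * f 0 + (fdiff j (\<lambda>x. f (Suc x)) + \<dots>) =
      fdiff j (\<lambda>x. f (Suc x)) - fdiff j f"
    by (simp add: fdiff_def sum.atMost_shift [where g = "\<lambda>l. (- 1) ^ (j + l) * real (j choose l) * f l"]
        flip: sum_negf)
  also have "\<dots> = fdiff j (\<lambda>x. f (Suc x) - f x)"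
    by (simp add: fdiff_def sum_subtractf algebra_simps)
  finally show ?thesis .
qed

lemma fdiff_add: "fdiff j (\<lambda>x. f x + g x) = fdiff j f + fdiff j g"
  by (simp add: fdiff_def sum.distrib algebra_simps)

lemma fdiff_cmult: "fdiff j (\<lambda>x. c * f x) = c * fdiff j f"
  by (simp add: fdiff_def sum_distrib_left mult_ac)

lemma fdiff_sum: "fdiff j (\<lambda>x. \<Sum>i\<in>A. f i x) = (\<Sum>i\<in>A. fdiff j (f i))"
  unfolding fdiff_def sum_distrib_left by (rule sum.swap)

lemma degree_shift_diff_less:
  fixes p :: "real poly"
  assumes "degree p \<noteq> 0"
  shows "degree (pcompose p [:1, 1:] - p) < degree p"
proof (rule degree_lessI)
  let ?q = "pcompose p [:1, 1:]"
  have deg: "degree ?q = degree p"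
    by (simp add: degree_pcompose)
  have "lead_coeff ?q = lead_coeff p"
    by (subst lead_coeff_comp) auto
  then show "\<forall>k\<ge>degree p. coeff (?q - p) k = 0"
    using deg by (auto simp: coeff_eq_0 le_less)
qed (use assms in auto)

text \<open>Each difference lowers the degree until a constant is reached, which the next difference
  kills.\<close>

lemma fdiff_poly_eq_0:
  assumes "degree p < j"
  shows "fdiff j (\<lambda>x. poly p (real x)) = 0"
  using assms
proof (induction j arbitrary: p)
  case (Suc j)
  let ?q = "pcompose p [:1, 1:] - p"
  have "fdiff (Suc j) (\<lambda>x. poly p (real x)) = fdiff j (\<lambda>x. poly ?q (real x))"
    by (simp add: fdiff_Suc poly_pcompose)
  also have "\<dots> = 0"
  proof (cases "degree p = 0")
    case True
    then obtain c where "p = [:c:]"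
      by (rule degree_eq_zeroE)
    then show ?thesis
      by (simp add: fdiff_def)
  next
    case False
    then have "degree ?q < j"
      using degree_shift_diff_less [of p] Suc.prems by simp
    then show ?thesis
      by (rule Suc.IH)
  qed
  finally show ?case .
qed simp

section \<open>Differences of binomials and harmonic numbers\<close>

text \<open>By Pascal's rule a difference lowers \<open>Suc k\<close> to \<open>k\<close>. For
  \<open>a = k\<close> this is the normalisation \<open>P\<^sub>k(1) = 1\<close>.\<close>

lemma fdiff_binomial: "fdiff k (\<lambda>x. real ((x + a) choose k)) = 1"
proof (induction k)
  case (Suc k)
  then show ?case
    by (simp add: fdiff_Suc)
qed simp

text \<open>A difference in \<open>x\<close> reproduces the expression with \<open>Suc k\<close>
  lowered to \<open>k\<close>; at \<open>k = 0\<close> only \<open>harm a\<close> remains.\<close>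

lemma fdiff_binomial_harm:
  "fdiff k (\<lambda>x. real ((x + a) choose k) * (harm (x + a) - harm k)) = harm a"
proof (induction k)
  case (Suc k)
  have "real (Suc (x + a) choose Suc k) * (harm (Suc (x + a)) - harm (Suc k)) -
        real ((x + a) choose Suc k) * (harm (x + a) - harm (Suc k)) =
        real ((x + a) choose k) * (harm (x + a) - harm k :: real)" for x
  proof -
    have "real (Suc k) * real (Suc (x + a) choose Suc k) = real (Suc (x + a)) * real ((x + a) choose k)"
      by (metis Suc_times_binomial_eq mult.commute of_nat_mult)
    then have "real (Suc (x + a) choose Suc k) / real (Suc (x + a)) = real ((x + a) choose k) / real (Suc k)"
      by (simp add: field_simps del: binomial_Suc_Suc)
    moreover have "real (Suc (x + a) choose Suc k) = real ((x + a) choose k) + real ((x + a) choose Suc k)"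
      by simp
    \<comment> \<open>The premises abstract the absorption identity and Pascal's rule shown just
      above.\<close>
    moreover have "B * (h + 1 / b - (g + 1 / d)) - C * (h - (g + 1 / d)) = D * (h - g)"
      if "B / b = D / d" "B = D + C" for B C D b d g h :: real
    proof -
      have "B * (h + 1 / b - (g + 1 / d)) - C * (h - (g + 1 / d)) =
          (B - C) * (h - g) + B / b - (B - C) / d"
        by (simp add: algebra_simps diff_divide_distrib)
      then show ?thesis
        using that by simp
    qed
    ultimately show ?thesis
      unfolding harm_Suc inverse_eq_divide by blast
  qed
  then show ?case
    using Suc by (simp add: fdiff_Suc del: binomial_Suc_Suc)
qed (simp add: harm_def)

text \<open>This is the orthogonality of \<open>P\<^sub>j\<close> to the \<open>m\<close>-th power; the quotient has degree \<open>j - 1\<close> in the index.\<close>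
lemma fdiff_binomial_divide_eq_0:
  assumes "m < j"
  shows "fdiff j (\<lambda>x. real ((x + j) choose j) / real (x + Suc m)) = 0"
proof -
  \<comment> \<open>The rising product from \<open>x + 1\<close> to \<open>x + j\<close> without the
    cancelled factor \<open>x + Suc m\<close>, which occurs because \<open>m < j\<close>.\<close>
  define p where "p = (\<Prod>s\<in>{1..j} - {Suc m}. [:real s, 1:])"
  have "degree p = j - 1"
    unfolding p_def using assms by (subst degree_prod_eq_sum_degree) auto
  moreover have "real ((x + j) choose j) / real (x + Suc m) = 1 / fact j * poly p (real x)" for x
  proof -
    have "fact j * real ((x + j) choose j) = (\<Prod>s\<in>{1..j}. real x + real s)"
    proof (induction j)
      case (Suc j)
      have "real (Suc j) * real (Suc (x + j) choose Suc j) = real (Suc (x + j)) * real ((x + j) choose j)"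
        by (metis Suc_times_binomial_eq mult.commute of_nat_mult)
      then have "fact (Suc j) * real ((x + Suc j) choose Suc j) =
          real (Suc (x + j)) * (fact j * real ((x + j) choose j))"
        by (simp del: binomial_Suc_Suc)
      also have "\<dots> = (\<Prod>s\<in>{1..Suc j}. real x + real s)"
        unfolding Suc.IH by simp
      finally show ?case .
    qed simp
    also have "\<dots> = (real x + real (Suc m)) * poly p (real x)"
      unfolding p_def poly_prod using assms
      by (subst prod.remove [of _ "Suc m"]) (auto simp: add_ac)
    finally show ?thesis
      by (simp add: field_simps)
  qed
  ultimately show ?thesis
    using assms by (simp only: fdiff_cmult) (simp add: fdiff_poly_eq_0)
qed

text \<open>The value of \<open>L (x^k P\<^sub>j)\<close>. Passing from \<open>harm (x + k)\<close>
  to \<open>harm (x + j)\<close> costs only reciprocals killed by orthogonality. One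
  \<open>harm j\<close> comes from \<open>fdiff_binomial_harm\<close>, the other from the subtracted
  constant there.\<close>

lemma fdiff_binomial_mult_harm:
  assumes "k \<le> j"
  shows "fdiff j (\<lambda>x. real ((x + j) choose j) * harm (x + k)) = 2 * harm j"
proof -
  have harm_shift: "harm (x + k) = harm (x + j) - (\<Sum>m=k..<j. 1 / real (x + Suc m))" for x
    using assms by (induction j rule: dec_induct) (simp_all add: harm_Suc inverse_eq_divide add_ac)
  have "fdiff j (\<lambda>x. real ((x + j) choose j) * harm (x + k)) =
      fdiff j (\<lambda>x. real ((x + j) choose j) * (harm (x + j) - harm j) +
        (harm j * real ((x + j) choose j) +
         (-1) * (\<Sum>m=k..<j. real ((x + j) choose j) / real (x + Suc m))))"
    unfolding harm_shift
    by (rule arg_cong [where f = "fdiff j"], rule ext) (simp add: algebra_simps sum_distrib_left sum_negf)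
  also have "\<dots> = harm j + (harm j * 1 + (-1) * (\<Sum>m=k..<j. 0))"
    unfolding fdiff_add fdiff_cmult fdiff_sum fdiff_binomial fdiff_binomial_harm
    by (intro arg_cong2 [where f = "(+)"] arg_cong2 [where f = "(*)"] sum.cong refl
      fdiff_binomial_divide_eq_0) simp
  finally show ?thesis
    by simp
qed

section \<open>Gram matrix in the Legendre basis\<close>

text \<open>The coefficient of \<open>x^l\<close> in the shifted Legendre polynomial \<open>P\<^sub>j\<close>.\<close>
definition legendre_coeff :: "nat \<Rightarrow> nat \<Rightarrow> real" where
  "legendre_coeff j l = (- 1) ^ (j + l) * real (j choose l) * real ((l + j) choose j)"

lemma sum_legendre_coeff:
  assumes "j < N"
  shows "(\<Sum>l<N. legendre_coeff j l * f l) = fdiff j (\<lambda>x. real ((x + j) choose j) * f x)"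
proof -
  have "(\<Sum>l<N. legendre_coeff j l * f l) = (\<Sum>l\<le>j. legendre_coeff j l * f l)"
    using assms by (intro sum.mono_neutral_right) (auto simp: legendre_coeff_def)
  then show ?thesis
    by (simp add: fdiff_def legendre_coeff_def mult_ac)
qed

text \<open>Coefficients with \<open>k > i\<close> vanish; for the others \<open>k \<le> j\<close>,
  so the inner sum does not depend on \<open>k\<close>, and \<open>P\<^sub>i(1) = 1\<close>
  finishes.\<close>

lemma legendre_gram_le:
  assumes "i \<le> j" "j < N"
  shows "(\<Sum>k<N. legendre_coeff i k * (\<Sum>l<N. legendre_coeff j l * harm (k + l))) = 2 * harm j"
proof -
  have "(\<Sum>k<N. legendre_coeff i k * (\<Sum>l<N. legendre_coeff j l * harm (k + l))) =
      (\<Sum>k<N. legendre_coeff i k * (2 * harm j))"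
  proof (rule sum.cong)
    fix k assume "k \<in> {..<N}"
    show "legendre_coeff i k * (\<Sum>l<N. legendre_coeff j l * harm (k + l)) =
        legendre_coeff i k * (2 * harm j)"
    proof (cases "k \<le> i")
      case True
      then have "k \<le> j"
        using assms by simp
      then show ?thesis
        using sum_legendre_coeff [OF assms(2), of "\<lambda>l. harm (k + l)"] fdiff_binomial_mult_harm [of k j]
        by (simp add: add.commute)
    qed (simp add: legendre_coeff_def)
  qed simp
  also have "\<dots> = (2 * harm j) * (\<Sum>k<N. legendre_coeff i k * 1)"
    by (simp add: sum_distrib_left mult_ac)
  also have "\<dots> = 2 * harm j"
    using assms by (subst sum_legendre_coeff) (simp_all add: fdiff_binomial)
  finally show ?thesis .
qed

lemma legendre_gram:
  assumes "i < N" "j < N"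
  shows "(\<Sum>k<N. legendre_coeff i k * (\<Sum>l<N. legendre_coeff j l * harm (k + l))) = 2 * harm (max i j)"
proof (cases "i \<le> j")
  case True
  then show ?thesis
    using legendre_gram_le assms by (simp add: max_def)
next
  case False
  have "(\<Sum>k<N. legendre_coeff i k * (\<Sum>l<N. legendre_coeff j l * harm (k + l))) =
      (\<Sum>l<N. legendre_coeff j l * (\<Sum>k<N. legendre_coeff i k * harm (l + k)))"
    unfolding sum_distrib_left by (subst sum.swap) (simp add: mult_ac add.commute)
  also have "\<dots> = 2 * harm i"
    using legendre_gram_le [of j i N] False assms by simp
  finally show ?thesis
    using False by (simp add: max_def)
qed

section \<open>Determinants by congruence\<close>

lemma mat_mult_mat:
  "Matrix.mat n n f * Matrix.mat n n g = Matrix.mat n n (\<lambda>(i, j). \<Sum>k<n. f (i, k) * g (k, j))"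
  by (rule eq_matI) (auto simp: scalar_prod_def lessThan_atLeast0)

lemma det_congruence_mat:
  fixes f g :: "nat \<Rightarrow> nat \<Rightarrow> 'a :: comm_ring_1"
  shows "Determinant.det (Matrix.mat n n (\<lambda>(i, j). \<Sum>k<n. f i k * (\<Sum>l<n. f j l * g k l))) =
    Determinant.det (Matrix.mat n n (\<lambda>(i, j). f i j)) ^ 2 *
    Determinant.det (Matrix.mat n n (\<lambda>(i, j). g i j))"
proof -
  define F where "F = Matrix.mat n n (\<lambda>(i, j). f i j)"
  define G where "G = Matrix.mat n n (\<lambda>(i, j). g i j)"
  have carrier: "F \<in> carrier_mat n n" "G \<in> carrier_mat n n"
    by (simp_all add: F_def G_def)
  have transpose: "transpose_mat F = Matrix.mat n n (\<lambda>(i, j). f j i)"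
    unfolding F_def by (rule eq_matI) auto
  have "Matrix.mat n n (\<lambda>(i, j). \<Sum>k<n. f i k * (\<Sum>l<n. f j l * g k l)) =
      F * (G * transpose_mat F)"
    unfolding transpose unfolding F_def G_def mat_mult_mat
    by (rule cong_mat) (simp_all add: mult.commute)
  then show ?thesis
    using carrier by (simp add: det_mult [of _ n] det_transpose [of _ n] power2_eq_square mult_ac
      flip: F_def G_def)
qed

text \<open>The matrix is \<open>U D U^T\<close>, with \<open>U\<close> upper triangular of ones and
  \<open>D\<close> diagonal.\<close>

lemma det_max_mat:
  fixes h :: "nat \<Rightarrow> 'a :: comm_ring_1"
  shows "Determinant.det (Matrix.mat (Suc n) (Suc n) (\<lambda>(i, j). h (max i j))) =
    h n * (\<Prod>k<n. h k - h (Suc k))"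
proof -
  \<comment> \<open>The last entry \<open>h n\<close> closes the telescoping sum, so that the tail
    from \<open>m\<close> equals \<open>h m\<close>.\<close>
  define d where "d k = (if k = n then h n else h k - h (Suc k))" for k
  define u where "u i k = (if i \<le> k then 1 else 0 :: 'a)" for i k :: nat
  define D where "D k l = (if k = l then d k else 0)" for k l
  have telescope: "(\<Sum>k=m..n. d k) = h m" if "m \<le> n" for m
    using that by (induction m rule: inc_induct) (simp_all add: d_def sum.atLeast_Suc_atMost)
  have entry: "(\<Sum>k<Suc n. u i k * (\<Sum>l<Suc n. u j l * D k l)) = h (max i j)"
    if "i < Suc n" "j < Suc n" for i j
  proof -
    have "(\<Sum>k<Suc n. u i k * (\<Sum>l<Suc n. u j l * D k l)) = (\<Sum>k<Suc n. u i k * (u j k * d k))"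
      unfolding D_def by (intro sum.cong) (auto simp: if_distrib sum.delta cong: if_cong)
    also have "\<dots> = (\<Sum>k=max i j..n. u i k * (u j k * d k))"
      by (rule sum.mono_neutral_right) (auto simp: u_def)
    also have "\<dots> = (\<Sum>k=max i j..n. d k)"
      by (rule sum.cong) (auto simp: u_def)
    finally show ?thesis
      using that by (simp add: telescope)
  qed
  have "Determinant.det (Matrix.mat (Suc n) (Suc n) (\<lambda>(i, j). h (max i j))) =
      Determinant.det (Matrix.mat (Suc n) (Suc n)
        (\<lambda>(i, j). \<Sum>k<Suc n. u i k * (\<Sum>l<Suc n. u j l * D k l)))"
    by (intro arg_cong [where f = Determinant.det] cong_mat) (simp_all add: entry del: sum.lessThan_Suc)
  also have "\<dots> = Determinant.det (Matrix.mat (Suc n) (Suc n) (\<lambda>(i, j). u i j)) ^ 2 *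
      Determinant.det (Matrix.mat (Suc n) (Suc n) (\<lambda>(i, j). D i j))"
    by (rule det_congruence_mat)
  also have "Determinant.det (Matrix.mat (Suc n) (Suc n) (\<lambda>(i, j). u i j)) = 1"
    by (subst det_upper_triangular [of _ "Suc n"]) (auto simp: u_def prod_list_diag_prod)
  also have "Determinant.det (Matrix.mat (Suc n) (Suc n) (\<lambda>(i, j). D i j)) = (\<Prod>k<Suc n. d k)"
    by (subst det_lower_triangular [of "Suc n"])
      (auto simp: D_def prod_list_diag_prod lessThan_atLeast0)
  finally show ?thesis
    by (simp add: d_def mult.commute)
qed

section \<open>Central binomial products and the final evaluation\<close>

lemma central_binomial_Suc:
  "real (Suc n) * real ((2 * Suc n) choose Suc n) = 2 * real (2 * n + 1) * real ((2 * n) choose n)"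
proof -
  have "Suc n * ((2 * Suc n) choose Suc n) = 2 * (Suc n * ((2 * n + 1) choose n))"
    using Suc_times_binomial_eq [of "2 * n + 1" n] by (simp del: binomial_Suc_Suc add: mult.commute)
  also have "Suc n * ((2 * n + 1) choose n) = (2 * n + 1) * ((2 * n) choose n)"
    using Suc_times_binomial_eq [of "2 * n" n] binomial_symmetric [of n "2 * n + 1"]
    by (simp del: binomial_Suc_Suc add: mult.commute)
  finally have "real (Suc n * ((2 * Suc n) choose Suc n)) = real (2 * ((2 * n + 1) * ((2 * n) choose n)))"
    by (rule arg_cong)
  then show ?thesis
    by (simp only: of_nat_mult of_nat_numeral mult.assoc)
qed

text \<open>Matches the product of differences of \<open>2 * harm k\<close> and the squared
  change-of-basis determinant with the stated denominator.\<close>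

lemma prod_central_binomial:
  "(\<Prod>k<n. - 2 / real (Suc k)) *
     (real ((2 * n) choose n) * (\<Prod>j<n. real (2 * j + 1) * real ((2 * j) choose j) ^ 2)) =
   (- 1) ^ n * (\<Prod>i<Suc n. real ((2 * i) choose i)) ^ 2"
proof (induction n)
  case (Suc n)
  define P Q R b where "P = (\<Prod>k<n. - 2 / real (Suc k))"
    and "Q = (\<Prod>j<n. real (2 * j + 1) * real ((2 * j) choose j) ^ 2)"
    and "R = (\<Prod>i<Suc n. real ((2 * i) choose i))"
    and "b = real ((2 * Suc n) choose Suc n)"
  have IH: "P * (real ((2 * n) choose n) * Q) = (- 1) ^ n * R ^ 2"
    using Suc by (simp only: P_def Q_def R_def)
  have b: "2 * real (2 * n + 1) * real ((2 * n) choose n) / real (Suc n) = b"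
    using central_binomial_Suc [of n] by (simp only: b_def) (simp add: field_simps)
  \<comment> \<open>One old central binomial combines with the ratio to give a second
    \<open>b\<close>; the other completes the induction hypothesis.\<close>
  have "(P * (- 2 / real (Suc n))) * (b * (Q * (real (2 * n + 1) * real ((2 * n) choose n) ^ 2))) =
      - b * (2 * real (2 * n + 1) * real ((2 * n) choose n) / real (Suc n)) *
        (P * (real ((2 * n) choose n) * Q))"
    by (simp add: power2_eq_square)
  also have "\<dots> = (- 1) ^ Suc n * (R * b) ^ 2"
    unfolding b IH by (simp add: power2_eq_square)
  finally show ?case
    unfolding P_def Q_def R_def b_def by (simp only: prod.lessThan_Suc)
qed simp

theorem theorem4p1:
  fixes n :: nat
  shows "Determinant.det (Matrix.mat (n + 1) (n + 1) (\<lambda>(i, j). harm (i + j) :: real)) =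
    (- 1) ^ n * (2 * harm n /
      (real ((2 * n) choose n) *
       (\<Prod>j = 1..<n. real (2 * j + 1) * real ((2 * j) choose j) ^ 2)))"
proof -
  define B where "B = (\<Prod>i<Suc n. real ((2 * i) choose i))"
  define q where "q j = real (2 * j + 1) * real ((2 * j) choose j) ^ 2" for j
  define H where "H = Determinant.det (Matrix.mat (Suc n) (Suc n) (\<lambda>(i, j). harm (i + j) :: real))"
  have nonzero: "B \<noteq> 0" "real ((2 * n) choose n) * (\<Prod>j<n. q j) \<noteq> 0"
    by (auto simp: B_def q_def)
  \<comment> \<open>Triangular since \<open>P\<^sub>i\<close> has degree \<open>i\<close>; on the
    diagonal the sign exponent \<open>i + i\<close> is even.\<close>
  have det_coeff: "Determinant.det (Matrix.mat (Suc n) (Suc n) (\<lambda>(i, j). legendre_coeff i j)) = B"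
    unfolding B_def
    by (subst det_lower_triangular [of "Suc n"])
      (auto simp: legendre_coeff_def prod_list_diag_prod lessThan_atLeast0 simp flip: mult_2)
  have "B ^ 2 * H = Determinant.det (Matrix.mat (Suc n) (Suc n)
      (\<lambda>(i, j). \<Sum>k<Suc n. legendre_coeff i k * (\<Sum>l<Suc n. legendre_coeff j l * harm (k + l))))"
    unfolding det_congruence_mat det_coeff H_def ..
  also have "\<dots> = Determinant.det (Matrix.mat (Suc n) (Suc n) (\<lambda>(i, j). 2 * harm (max i j)))"
    by (intro arg_cong [where f = Determinant.det] cong_mat)
      (simp_all add: legendre_gram del: sum.lessThan_Suc)
  also have "\<dots> = 2 * harm n * (\<Prod>k<n. - 2 / real (Suc k))"
    by (subst det_max_mat [of n "\<lambda>k. 2 * harm k"]) (simp add: harm_Suc field_simps)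
  finally have "B ^ 2 * H = 2 * harm n * (\<Prod>k<n. - 2 / real (Suc k))" .
  then have "B ^ 2 * (H * (real ((2 * n) choose n) * (\<Prod>j<n. q j))) =
      2 * harm n * ((\<Prod>k<n. - 2 / real (Suc k)) * (real ((2 * n) choose n) * (\<Prod>j<n. q j)))"
    by (simp only: flip: mult.assoc)
  also have "\<dots> = B ^ 2 * ((- 1) ^ n * (2 * harm n))"
    unfolding q_def prod_central_binomial B_def by (simp only: mult_ac)
  finally have "H * (real ((2 * n) choose n) * (\<Prod>j<n. q j)) = (- 1) ^ n * (2 * harm n)"
    using nonzero by simp
  then have "H = (- 1) ^ n * (2 * harm n / (real ((2 * n) choose n) * (\<Prod>j<n. q j)))"
    using nonzero by (simp add: field_simps)
  \<comment> \<open>The factor at \<open>j = 0\<close> is 1.\<close>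
  moreover have "(\<Prod>j<n. q j) = (\<Prod>j=1..<n. q j)"
    by (rule prod.mono_neutral_right) (auto simp: q_def not_less_eq_eq)
  ultimately show ?thesis
    by (simp add: H_def q_def)
qed

end
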